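(* Let $X=X_T$ be the binary tree space. The set $\mathrm{PC}(B_X)$ of points of continuity of $B_X$ is weakly dense in $B_X$. In particular, $(B_X,w)$ has a countable $\pi$-base.
   Context: Binary tree space: $T=\{\emptyset\}\cup\bigcup_{n\in\mathbb{N}}\{0,1\}^n$ is the infinite binary tree of finite $0$-$1$ sequences, ordered by $s\preceq t$ iff $s$ is an initial segment of $t$. A chain is a non-empty (totally, hence well) ordered subset of $T$; $\mathcal{A}$ is the collection of all chains. $X=X_T$ is the real Banach space obtained by completing the space $c_{00}(T)$ of finitely supported real functions on $T$ for the norm $\|x\|=\sup_{A\in\mathcal{A}}\sum_{t\in A}|x(t)|$. $B_X$ is its closed unit ball, and $(B_X,w)$ is $B_X$ with the relative weak topology. A point $x\in B_X$ is a point of continuity of $B_X$ if the identity map $(B_X,w)\to(B_X,\|\cdot\|)$ is continuous at $x$, i.e. $x$ is contained in relatively weakly open subsets of $B_X$ of arbitrarily small diameter. A $\pi$-base of a topological space is a collection $\{V_i\}_{i\in I}$ of non-empty open subsets such that every non-empty open subset contains one of the sets $V_i$. *)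

theory Defs
  imports "HOL-Analysis.Analysis" "HOL-Library.Sublist"
begin

section \<open>The weak topology, points of continuity and pi-bases\<close>

definition weak_topology :: "'a::real_normed_vector topology" where
  "weak_topology = topology_generated_by
     {f -` U | (f :: 'a \<Rightarrow> real) U. bounded_linear f \<and> open U}"

lemma topspace_weak_topology [simp]: "topspace weak_topology = (UNIV :: 'a::real_normed_vector set)"
proof -
  have "(\<lambda>_::'a. 0::real) -` UNIV \<in> {f -` U | (f :: 'a \<Rightarrow> real) U. bounded_linear f \<and> open U}"
    using bounded_linear_zero open_UNIV by blast
  then show ?thesis
    unfolding weak_topology_def topology_generated_by_topspace by auto
qed

definition points_of_continuity :: "'a::real_normed_vector set \<Rightarrow> 'a set" where
  "points_of_continuity C =
     {x \<in> C. topcontinuous_at (subtopology weak_topology C) (top_of_set C) (\<lambda>y. y) x}"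

definition pi_base :: "'a topology \<Rightarrow> 'a set set \<Rightarrow> bool" where
  "pi_base X \<V> \<longleftrightarrow>
     (\<forall>V\<in>\<V>. openin X V \<and> V \<noteq> {}) \<and>
     (\<forall>U. openin X U \<and> U \<noteq> {} \<longrightarrow> (\<exists>V\<in>\<V>. V \<subseteq> U))"

section \<open>The norm of the binary tree space\<close>

text \<open>The tree \<open>T\<close> is the type of all finite lists of booleans (\<open>False\<close> for 0, \<open>True\<close> for 1),
  ordered by \<^const>\<open>prefix\<close>.\<close>

type_synonym node = "bool list"

definition tree_chains :: "node set set" where
  "tree_chains = {A. A \<noteq> {} \<and> Complete_Partial_Order.chain prefix A}"

definition tree_norm :: "(node \<Rightarrow> real) \<Rightarrow> real" where
  "tree_norm x = (SUP A\<in>tree_chains. \<Sum>\<^sub>\<infinity>t\<in>A. \<bar>x t\<bar>)"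

text \<open>The functions for which the supremum in \<^const>\<open>tree_norm\<close> is genuinely finite; outside this
  set its value has no meaning.\<close>

definition tree_bounded :: "(node \<Rightarrow> real) set" where
  "tree_bounded = {x. (\<forall>A\<in>tree_chains. (\<lambda>t. \<bar>x t\<bar>) summable_on A) \<and>
     bdd_above ((\<lambda>A. \<Sum>\<^sub>\<infinity>t\<in>A. \<bar>x t\<bar>) ` tree_chains)}"

definition finitely_supported :: "(node \<Rightarrow> real) set" where
  "finitely_supported = {x. finite {t. x t \<noteq> 0}}"

lemma tree_chains_subset: "A \<in> tree_chains \<Longrightarrow> F \<subseteq> A \<Longrightarrow> F \<noteq> {} \<Longrightarrow> F \<in> tree_chains"
  unfolding tree_chains_def using chain_subset[of prefix A F] by auto

lemma singleton_tree_chains: "{t} \<in> tree_chains"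
  unfolding tree_chains_def chain_def by auto

lemma sum_le_tree_norm:
  assumes "x \<in> tree_bounded" "F \<in> tree_chains" "finite F"
  shows "(\<Sum>t\<in>F. \<bar>x t\<bar>) \<le> tree_norm x"
  unfolding tree_norm_def
  using cSUP_upper[of F tree_chains "\<lambda>A. \<Sum>\<^sub>\<infinity>t\<in>A. \<bar>x t\<bar>"] assms
  by (auto simp: tree_bounded_def)

lemma tree_norm_bound:
  assumes "\<And>F. F \<in> tree_chains \<Longrightarrow> finite F \<Longrightarrow> (\<Sum>t\<in>F. \<bar>x t\<bar>) \<le> M"
  shows "x \<in> tree_bounded" "tree_norm x \<le> M"
proof -
  have "0 \<le> M"
    using assms[OF singleton_tree_chains[of "[]"]] by simp
  then have fin: "(\<Sum>t\<in>F. \<bar>x t\<bar>) \<le> M" if "A \<in> tree_chains" "finite F" "F \<subseteq> A" for A F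
    using assms[OF tree_chains_subset[OF that(1,3)]] that by (cases "F = {}") auto
  have summ: "(\<lambda>t. \<bar>x t\<bar>) summable_on A" if "A \<in> tree_chains" for A
    using fin[OF that] by (intro nonneg_bounded_partial_sums_imp_summable_on[where C = M])
      (auto simp: eventually_finite_subsets_at_top intro!: exI[of _ "{}"])
  have le: "(\<Sum>\<^sub>\<infinity>t\<in>A. \<bar>x t\<bar>) \<le> M" if "A \<in> tree_chains" for A
    using summ[OF that] fin[OF that] by (rule infsum_le_finite_sums)
  show "x \<in> tree_bounded"
    unfolding tree_bounded_def using summ le by (auto intro!: bdd_aboveI[of _ M])
  show "tree_norm x \<le> M"
    unfolding tree_norm_def
    using singleton_tree_chains le by (intro cSUP_least) auto
qed

lemma abs_le_tree_norm: "x \<in> tree_bounded \<Longrightarrow> \<bar>x t\<bar> \<le> tree_norm x"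
  using sum_le_tree_norm[of x "{t}"] singleton_tree_chains by simp

lemma tree_norm_nonneg: "x \<in> tree_bounded \<Longrightarrow> 0 \<le> tree_norm x"
  using abs_le_tree_norm[of x "[]"] by linarith

lemma tree_norm_add:
  assumes "x \<in> tree_bounded" "y \<in> tree_bounded"
  shows "(\<lambda>t. x t + y t) \<in> tree_bounded" "tree_norm (\<lambda>t. x t + y t) \<le> tree_norm x + tree_norm y"
proof -
  have "(\<Sum>t\<in>F. \<bar>x t + y t\<bar>) \<le> tree_norm x + tree_norm y"
    if F: "F \<in> tree_chains" "finite F" for F
  proof -
    have "(\<Sum>t\<in>F. \<bar>x t + y t\<bar>) \<le> (\<Sum>t\<in>F. \<bar>x t\<bar> + \<bar>y t\<bar>)"
      by (intro sum_mono abs_triangle_ineq)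
    also have "\<dots> \<le> tree_norm x + tree_norm y"
      using sum_le_tree_norm[OF assms(1) F] sum_le_tree_norm[OF assms(2) F]
      by (simp add: sum.distrib)
    finally show ?thesis .
  qed
  then show "(\<lambda>t. x t + y t) \<in> tree_bounded"
      "tree_norm (\<lambda>t. x t + y t) \<le> tree_norm x + tree_norm y"
    using tree_norm_bound[of "\<lambda>t. x t + y t" "tree_norm x + tree_norm y"] by blast+
qed

lemma tree_norm_scale:
  assumes "x \<in> tree_bounded"
  shows "(\<lambda>t. c * x t) \<in> tree_bounded" "tree_norm (\<lambda>t. c * x t) = \<bar>c\<bar> * tree_norm x"
proof -
  have *: "(\<lambda>t. c * x t) \<in> tree_bounded \<and> tree_norm (\<lambda>t. c * x t) \<le> \<bar>c\<bar> * tree_norm x"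
    if "x \<in> tree_bounded" for c x
  proof -
    have "(\<Sum>t\<in>F. \<bar>c * x t\<bar>) \<le> \<bar>c\<bar> * tree_norm x" if F: "F \<in> tree_chains" "finite F" for F
      using mult_left_mono[OF sum_le_tree_norm[OF \<open>x \<in> tree_bounded\<close> F], of "\<bar>c\<bar>"]
      by (simp add: abs_mult sum_distrib_left)
    then show ?thesis
      using tree_norm_bound[of "\<lambda>t. c * x t" "\<bar>c\<bar> * tree_norm x"] by blast
  qed
  show "(\<lambda>t. c * x t) \<in> tree_bounded"
    using *[OF assms] by blast
  show "tree_norm (\<lambda>t. c * x t) = \<bar>c\<bar> * tree_norm x"
  proof (cases "c = 0")
    case True
    then show ?thesis
      using *[OF assms, of 0] tree_norm_nonneg[of "\<lambda>t. 0"] by simp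
  next
    case False
    then show ?thesis
      using *[OF assms, of c] *[of "\<lambda>t. c * x t" "inverse c"]
      by (simp add: field_simps flip: mult.assoc)
  qed
qed

lemma tree_norm_minus: "tree_norm (\<lambda>t. x t - y t) = tree_norm (\<lambda>t. y t - x t)"
  by (simp add: tree_norm_def abs_minus_commute)

lemma tree_bounded_diff:
  assumes "x \<in> tree_bounded" "y \<in> tree_bounded"
  shows "(\<lambda>t. x t - y t) \<in> tree_bounded"
  using tree_norm_add(1)[OF assms(1) tree_norm_scale(1)[OF assms(2), of "- 1"]] by simp

lemma finitely_supported_tree_bounded:
  assumes "x \<in> finitely_supported"
  shows "x \<in> tree_bounded"
proof (rule tree_norm_bound(1))
  fix F :: "node set" assume "F \<in> tree_chains" "finite F"
  have "(\<Sum>t\<in>F. \<bar>x t\<bar>) = (\<Sum>t\<in>F \<inter> {t. x t \<noteq> 0}. \<bar>x t\<bar>)"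
    using \<open>finite F\<close> by (intro sum.mono_neutral_right) auto
  also have "\<dots> \<le> (\<Sum>t\<in>{t. x t \<noteq> 0}. \<bar>x t\<bar>)"
    using assms by (intro sum_mono2) (auto simp: finitely_supported_def)
  finally show "(\<Sum>t\<in>F. \<bar>x t\<bar>) \<le> (\<Sum>t\<in>{t. x t \<noteq> 0}. \<bar>x t\<bar>)" .
qed

lemma zero_finitely_supported: "(\<lambda>t. 0) \<in> finitely_supported"
  by (simp add: finitely_supported_def)

lemma tree_norm_zero: "tree_norm (\<lambda>t. 0) = 0"
  using tree_norm_scale(2)[OF finitely_supported_tree_bounded[OF zero_finitely_supported], of 0]
  by simp

lemma finitely_supported_add:
  assumes "x \<in> finitely_supported" "y \<in> finitely_supported"
  shows "(\<lambda>t. x t + y t) \<in> finitely_supported"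
proof -
  have "{t. x t + y t \<noteq> 0} \<subseteq> {t. x t \<noteq> 0} \<union> {t. y t \<noteq> 0}"
    by auto
  then show ?thesis
    using assms finite_subset unfolding finitely_supported_def by blast
qed

lemma finitely_supported_scale:
  "x \<in> finitely_supported \<Longrightarrow> (\<lambda>t. c * x t) \<in> finitely_supported"
  by (cases "c = 0") (simp_all add: finitely_supported_def)

section \<open>The binary tree space\<close>

text \<open>The completion of the finitely supported functions is realised as their closure in the Banach
  space of all functions of finite tree norm. That this is a completion is confirmed below: the type
  is an instance of \<^class>\<open>banach\<close>, and it contains the finitely supported functions
  isometrically (\<open>ex_tree_coord\<close>, \<open>norm_tree_space\<close>) and densely (\<open>closure_finitely_supported\<close>).\<close>

typedef tree_space =
  "{x \<in> tree_bounded. \<forall>e>0. \<exists>y\<in>finitely_supported. tree_norm (\<lambda>t. x t - y t) < e}"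
  morphisms tree_coord Abs_tree_space
  using tree_norm_zero zero_finitely_supported finitely_supported_tree_bounded
  by (intro exI[of _ "\<lambda>t. 0"]) (auto intro!: bexI[of _ "\<lambda>t. 0"])

setup_lifting type_definition_tree_space

lemma tree_coord_bounded: "tree_coord x \<in> tree_bounded"
  using tree_coord[of x] by simp

instantiation tree_space :: real_vector
begin

lift_definition zero_tree_space :: tree_space is "\<lambda>t. 0"
  using tree_norm_zero zero_finitely_supported finitely_supported_tree_bounded
  by (auto intro!: bexI[of _ "\<lambda>t. 0"])

lift_definition plus_tree_space :: "tree_space \<Rightarrow> tree_space \<Rightarrow> tree_space" is "\<lambda>x y t. x t + y t"
proof (clarsimp simp: tree_norm_add(1))
  fix x y and e :: real
  assume b: "x \<in> tree_bounded" "y \<in> tree_bounded" and "0 < e"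
    and "\<forall>e>0. \<exists>z\<in>finitely_supported. tree_norm (\<lambda>t. x t - z t) < e"
    and "\<forall>e>0. \<exists>z\<in>finitely_supported. tree_norm (\<lambda>t. y t - z t) < e"
  then obtain u v where uv: "u \<in> finitely_supported" "v \<in> finitely_supported"
    "tree_norm (\<lambda>t. x t - u t) < e / 2" "tree_norm (\<lambda>t. y t - v t) < e / 2"
    by (meson half_gt_zero)
  then have "tree_norm (\<lambda>t. (x t - u t) + (y t - v t)) < e"
    using tree_norm_add(2)[OF tree_bounded_diff tree_bounded_diff, OF b(1) _ b(2),
        OF finitely_supported_tree_bounded finitely_supported_tree_bounded, of u v] by linarith
  then show "\<exists>z\<in>finitely_supported. tree_norm (\<lambda>t. x t + y t - z t) < e"
    using uv by (intro bexI[of _ "\<lambda>t. u t + v t"] finitely_supported_add) (simp_all add: algebra_simps)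
qed

lift_definition scaleR_tree_space :: "real \<Rightarrow> tree_space \<Rightarrow> tree_space" is "\<lambda>c x t. c * x t"
proof (clarsimp simp: tree_norm_scale(1))
  fix x and c e :: real
  assume b: "x \<in> tree_bounded" and "0 < e"
    and "\<forall>e>0. \<exists>z\<in>finitely_supported. tree_norm (\<lambda>t. x t - z t) < e"
  moreover from \<open>0 < e\<close> have "0 < e / (\<bar>c\<bar> + 1)" by simp
  ultimately obtain u where u: "u \<in> finitely_supported" "tree_norm (\<lambda>t. x t - u t) < e / (\<bar>c\<bar> + 1)"
    by meson
  then have bu: "(\<lambda>t. x t - u t) \<in> tree_bounded"
    using tree_bounded_diff[OF b finitely_supported_tree_bounded] by blast
  have "tree_norm (\<lambda>t. c * (x t - u t)) = \<bar>c\<bar> * tree_norm (\<lambda>t. x t - u t)"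
    using tree_norm_scale(2)[OF bu] .
  also have "\<dots> \<le> (\<bar>c\<bar> + 1) * tree_norm (\<lambda>t. x t - u t)"
    using tree_norm_nonneg[OF bu] by (intro mult_right_mono) auto
  also have "\<dots> < e"
    using u(2) by (subst (asm) pos_less_divide_eq) (auto simp: mult.commute)
  finally show "\<exists>z\<in>finitely_supported. tree_norm (\<lambda>t. c * x t - z t) < e"
    using u(1) by (intro bexI[of _ "\<lambda>t. c * u t"] finitely_supported_scale) (simp_all add: algebra_simps)
qed

definition uminus_tree_space :: "tree_space \<Rightarrow> tree_space" where
  "- x = (- 1) *\<^sub>R (x :: tree_space)"

definition minus_tree_space :: "tree_space \<Rightarrow> tree_space \<Rightarrow> tree_space" where
  "x - y = x + - (y :: tree_space)"

instance
proof
  fix x y z :: tree_space and a b :: real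
  show "x + y + z = x + (y + z)" by transfer (simp add: algebra_simps)
  show "x + y = y + x" by transfer (simp add: algebra_simps)
  show "0 + x = x" by transfer simp
  show "- x + x = 0" unfolding uminus_tree_space_def by transfer simp
  show "x - y = x + - y" by (rule minus_tree_space_def)
  show "a *\<^sub>R (x + y) = a *\<^sub>R x + a *\<^sub>R y" by transfer (simp add: algebra_simps)
  show "(a + b) *\<^sub>R x = a *\<^sub>R x + b *\<^sub>R x" by transfer (simp add: algebra_simps)
  show "a *\<^sub>R b *\<^sub>R x = (a * b) *\<^sub>R x" by transfer (simp add: algebra_simps)
  show "1 *\<^sub>R x = x" by transfer simp
qed

end

lemma tree_coord_simps [simp]:
  "tree_coord 0 t = 0"
  "tree_coord (x + y) t = tree_coord x t + tree_coord y t"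
  "tree_coord (c *\<^sub>R x) t = c * tree_coord x t"
  by (transfer, simp)+

lemma tree_coord_uminus [simp]: "tree_coord (- x) t = - tree_coord x t"
  unfolding uminus_tree_space_def tree_coord_simps by simp

lemma tree_coord_diff [simp]: "tree_coord (x - y) t = tree_coord x t - tree_coord y t"
  unfolding minus_tree_space_def tree_coord_simps tree_coord_uminus by simp

lemma tree_space_eqI: "(\<And>t. tree_coord x t = tree_coord y t) \<Longrightarrow> x = y"
  by (simp add: fun_eq_iff flip: tree_coord_inject)

instantiation tree_space :: real_normed_vector
begin

lift_definition norm_tree_space :: "tree_space \<Rightarrow> real" is tree_norm .

definition dist_tree_space :: "tree_space \<Rightarrow> tree_space \<Rightarrow> real" where
  "dist x y = norm (x - (y :: tree_space))"

definition sgn_tree_space :: "tree_space \<Rightarrow> tree_space" where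
  "sgn x = (x :: tree_space) /\<^sub>R norm x"

definition uniformity_tree_space :: "(tree_space \<times> tree_space) filter" where
  "uniformity = (INF e\<in>{0<..}. principal {(x, y :: tree_space). dist x y < e})"

definition open_tree_space :: "tree_space set \<Rightarrow> bool" where
  "open U \<longleftrightarrow> (\<forall>x\<in>U. \<forall>\<^sub>F (x', y) in uniformity. x' = x \<longrightarrow> (y :: tree_space) \<in> U)"

instance
proof
  fix x y :: tree_space and c :: real and U :: "tree_space set"
  show "dist x y = norm (x - y)"
    by (rule dist_tree_space_def)
  show "sgn x = x /\<^sub>R norm x"
    by (rule sgn_tree_space_def)
  show "uniformity = (INF e\<in>{0<..}. principal {(x, y :: tree_space). dist x y < e})"
    by (rule uniformity_tree_space_def)
  show "open U \<longleftrightarrow> (\<forall>x\<in>U. \<forall>\<^sub>F (x', y) in uniformity. x' = x \<longrightarrow> y \<in> U)"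
    by (rule open_tree_space_def)
  show "norm x = 0 \<longleftrightarrow> x = 0"
  proof
    assume "norm x = 0"
    then have "\<bar>tree_coord x t\<bar> \<le> 0" for t
      using abs_le_tree_norm[OF tree_coord_bounded, of x t] by (simp only: norm_tree_space.rep_eq)
    then show "x = 0"
      by (intro tree_space_eqI) simp
  next
    assume "x = 0"
    then show "norm x = 0"
      by (simp only: norm_tree_space.rep_eq zero_tree_space.rep_eq tree_norm_zero)
  qed
  show "norm (x + y) \<le> norm x + norm y"
    using tree_norm_add(2)[OF tree_coord_bounded[of x] tree_coord_bounded[of y]]
    by (simp only: norm_tree_space.rep_eq plus_tree_space.rep_eq)
  show "norm (c *\<^sub>R x) = \<bar>c\<bar> * norm x"
    using tree_norm_scale(2)[OF tree_coord_bounded[of x], of c]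
    by (simp only: norm_tree_space.rep_eq scaleR_tree_space.rep_eq)
qed

end

lemma norm_tree_space: "norm x = tree_norm (tree_coord x)"
  by (rule norm_tree_space.rep_eq)

lemma ex_tree_coord:
  assumes "f \<in> finitely_supported"
  shows "\<exists>x. tree_coord x = f"
proof -
  have "f \<in> {x \<in> tree_bounded. \<forall>e>0. \<exists>y\<in>finitely_supported. tree_norm (\<lambda>t. x t - y t) < e}"
    using assms by (auto simp: finitely_supported_tree_bounded tree_norm_zero intro!: bexI[of _ f])
  then show ?thesis
    by (intro exI[of _ "Abs_tree_space f"] Abs_tree_space_inverse)
qed

lemma closure_finitely_supported:
  "closure {x. tree_coord x \<in> finitely_supported} = UNIV"
proof -
  have "\<exists>y\<in>{x. tree_coord x \<in> finitely_supported}. dist y x < e" if "0 < e" for x e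
  proof -
    obtain f where f: "f \<in> finitely_supported" "tree_norm (\<lambda>t. tree_coord x t - f t) < e"
      using tree_coord[of x] \<open>0 < e\<close> by auto
    then obtain y where "tree_coord y = f"
      using ex_tree_coord by blast
    moreover from this have "tree_coord (y - x) = (\<lambda>t. f t - tree_coord x t)"
      by auto
    ultimately show ?thesis
      using f tree_norm_minus[of "tree_coord x" f]
      by (intro bexI[of _ y]) (simp_all add: dist_norm norm_tree_space)
  qed
  then show ?thesis
    by (auto simp: closure_approachable)
qed

lemma abs_tree_coord_le_norm: "\<bar>tree_coord x t\<bar> \<le> norm x"
  using abs_le_tree_norm[OF tree_coord_bounded] by (simp add: norm_tree_space)

instance tree_space :: banach
proof
  fix X :: "nat \<Rightarrow> tree_space" assume "Cauchy X"
  have "Cauchy (\<lambda>n. tree_coord (X n) t)" for t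
  proof (rule metric_CauchyI)
    fix e :: real assume "0 < e"
    then obtain N where "\<And>m n. N \<le> m \<Longrightarrow> N \<le> n \<Longrightarrow> norm (X m - X n) < e"
      using CauchyD[OF \<open>Cauchy X\<close>] by blast
    then have "dist (tree_coord (X m) t) (tree_coord (X n) t) < e" if "N \<le> m" "N \<le> n" for m n
      using abs_tree_coord_le_norm[of "X m - X n" t] that by (force simp: dist_real_def)
    then show "\<exists>N. \<forall>m\<ge>N. \<forall>n\<ge>N. dist (tree_coord (X m) t) (tree_coord (X n) t) < e"
      by blast
  qed
  define f where "f t = lim (\<lambda>n. tree_coord (X n) t)" for t
  have f: "(\<lambda>n. tree_coord (X n) t) \<longlonglongrightarrow> f t" for t
    unfolding f_def using \<open>Cauchy (\<lambda>n. tree_coord (X n) t)\<close>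
    by (simp add: Cauchy_convergent convergent_LIMSEQ_iff[symmetric])
  have close: "\<exists>N. \<forall>n\<ge>N. (\<lambda>t. f t - tree_coord (X n) t) \<in> tree_bounded \<and>
      tree_norm (\<lambda>t. f t - tree_coord (X n) t) \<le> e" if "0 < e" for e
  proof -
    obtain N where N: "\<And>m n. N \<le> m \<Longrightarrow> N \<le> n \<Longrightarrow> norm (X m - X n) < e"
      using CauchyD[OF \<open>Cauchy X\<close> \<open>0 < e\<close>] by blast
    have "(\<Sum>t\<in>F. \<bar>f t - tree_coord (X n) t\<bar>) \<le> e"
      if "N \<le> n" and F: "F \<in> tree_chains" "finite F" for n F
    proof (rule LIMSEQ_le_const2)
      show "(\<lambda>m. \<Sum>t\<in>F. \<bar>tree_coord (X m) t - tree_coord (X n) t\<bar>)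
          \<longlonglongrightarrow> (\<Sum>t\<in>F. \<bar>f t - tree_coord (X n) t\<bar>)"
        by (intro tendsto_intros f)
      have "(\<Sum>t\<in>F. \<bar>tree_coord (X m) t - tree_coord (X n) t\<bar>) \<le> e" if "N \<le> m" for m
        using sum_le_tree_norm[OF tree_coord_bounded F, of "X m - X n"] N[OF that \<open>N \<le> n\<close>]
        by (simp add: norm_tree_space)
      then show "\<exists>N. \<forall>m\<ge>N. (\<Sum>t\<in>F. \<bar>tree_coord (X m) t - tree_coord (X n) t\<bar>) \<le> e"
        by blast
    qed
    then have "(\<lambda>t. f t - tree_coord (X n) t) \<in> tree_bounded \<and>
        tree_norm (\<lambda>t. f t - tree_coord (X n) t) \<le> e" if "N \<le> n" for n
      using tree_norm_bound[of "\<lambda>t. f t - tree_coord (X n) t" e] that by simp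
    then show ?thesis
      by blast
  qed
  have "f \<in> tree_bounded"
  proof -
    obtain n where "(\<lambda>t. f t - tree_coord (X n) t) \<in> tree_bounded"
      using close[of 1] by auto
    from tree_norm_add(1)[OF this tree_coord_bounded[of "X n"]] show ?thesis by simp
  qed
  moreover have "\<exists>y\<in>finitely_supported. tree_norm (\<lambda>t. f t - y t) < e" if "0 < e" for e
  proof -
    obtain n where n: "(\<lambda>t. f t - tree_coord (X n) t) \<in> tree_bounded"
        "tree_norm (\<lambda>t. f t - tree_coord (X n) t) \<le> e / 2"
      using close[of "e / 2"] \<open>0 < e\<close> by auto
    obtain y where y: "y \<in> finitely_supported" "tree_norm (\<lambda>t. tree_coord (X n) t - y t) < e / 2"
      using tree_coord[of "X n"] half_gt_zero[OF \<open>0 < e\<close>] by blast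
    have "(\<lambda>t. tree_coord (X n) t - y t) \<in> tree_bounded"
      using tree_bounded_diff[OF tree_coord_bounded finitely_supported_tree_bounded] y by blast
    from tree_norm_add(2)[OF n(1) this] n(2) y show ?thesis
      by (intro bexI[of _ y]) auto
  qed
  ultimately have x: "tree_coord (Abs_tree_space f) = f"
    by (intro Abs_tree_space_inverse) simp
  define x where "x = Abs_tree_space f"
  have "X \<longlonglongrightarrow> x"
  proof (rule metric_LIMSEQ_I)
    fix e :: real assume "0 < e"
    then obtain N where N: "\<forall>n\<ge>N. tree_norm (\<lambda>t. f t - tree_coord (X n) t) \<le> e / 2"
      using close[of "e / 2"] by auto
    have "dist (X n) x = tree_norm (\<lambda>t. f t - tree_coord (X n) t)" for n
    proof -
      have "tree_coord (x - X n) = (\<lambda>t. f t - tree_coord (X n) t)"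
        using x by (auto simp: x_def)
      then show ?thesis
        by (subst dist_commute) (simp add: dist_norm norm_tree_space)
    qed
    then show "\<exists>N. \<forall>n\<ge>N. dist (X n) x < e"
      using N \<open>0 < e\<close> by (intro exI[of _ N]) force
  qed
  then show "convergent X"
    by (auto simp: convergent_def)
qed

end

theory Submission
  imports Defs
begin

text \<open>Call \<open>y\<close> in the unit ball \<^emph>\<open>saturated\<close> if for some level \<open>n\<close> the absolute values of the
  coordinates of \<open>y\<close> add up to 1 along every path of the tree from the root to level \<open>n\<close>.

  A saturated point is a point of continuity. Suppose that \<open>u\<close> in the ball is weakly close to \<open>y\<close>,
  so that the finitely many coordinates up to level \<open>n\<close> nearly agree. Then every path has already
  spent almost the whole norm budget 1 of \<open>u\<close> at level \<open>n\<close>, and hardly anything is left for \<open>u\<close>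
  below that level; for \<open>y\<close> itself nothing is left. So \<open>u\<close> and \<open>y\<close> are close in norm
  (\<open>saturated_point_of_continuity\<close>).

  Saturated points are weakly dense. A point \<open>x\<close> of the ball that is supported up to level \<open>N\<close> has
  an unspent amount \<open>r t\<close> on the path to each node \<open>t\<close> of level \<open>N\<close>. For \<open>m > N\<close> let \<open>u m\<close> take the
  value \<open>r t\<close> at all descendants of \<open>t\<close> of level \<open>m\<close>. All \<open>u m\<close> have norm at most 1, so among
  infinitely many of them two nearly agree under finitely many given functionals. Then
  \<open>x + (u m - u n) / 2\<close> is weakly close to \<open>x\<close>, although the two halves have disjoint supports and
  together fill up the budget on every path (\<open>saturation\<close>). Starting from vectors with rational
  coordinates, this produces only countably many saturated points.

  Each of them has weak neighbourhoods in the ball of diameter tending to 0. As weakly open sets are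
  norm open, these neighbourhoods form a \<open>\<pi>\<close>-base (\<open>countable_pi_base_weak\<close>).\<close>

section \<open>Weak neighbourhoods\<close>

lemma openin_weak_functional:
  fixes f :: "'a::real_normed_vector \<Rightarrow> real"
  assumes "bounded_linear f" "open U"
  shows "openin weak_topology (f -` U)"
  unfolding weak_topology_def using assms
  by (intro topology_generated_by_Basis CollectI exI[of _ f] exI[of _ U] conjI refl)

text \<open>By induction on the generation of \<open>U\<close> from the subbasis: for an intersection the two finite sets
  of functionals are united and the smaller tolerance is taken.\<close>

lemma weak_neighbourhood_functionals:
  fixes x :: "'a::real_normed_vector"
  assumes "openin weak_topology U" "x \<in> U"
  shows "\<exists>\<Phi> e. finite \<Phi> \<and> (\<forall>f\<in>\<Phi>. bounded_linear (f :: 'a \<Rightarrow> real)) \<and> 0 < e \<and>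
    {y. \<forall>f\<in>\<Phi>. \<bar>f y - f x\<bar> < e} \<subseteq> U"
proof -
  have "generate_topology_on {f -` U | (f :: 'a \<Rightarrow> real) U. bounded_linear f \<and> open U} U"
    using assms(1) unfolding weak_topology_def openin_topology_generated_by_iff .
  then show ?thesis
    using assms(2)
  proof induction
    case Empty
    then show ?case by simp
  next
    case (Int a b)
    have "x \<in> a" "x \<in> b"
      using Int.prems by simp_all
    obtain \<Phi> d where \<Phi>: "finite \<Phi>" "\<forall>f\<in>\<Phi>. bounded_linear (f :: 'a \<Rightarrow> real)" "0 < d"
        "{y. \<forall>f\<in>\<Phi>. \<bar>f y - f x\<bar> < d} \<subseteq> a"
      using Int.IH(1)[OF \<open>x \<in> a\<close>] by (elim exE conjE)
    obtain \<Psi> e where \<Psi>: "finite \<Psi>" "\<forall>f\<in>\<Psi>. bounded_linear (f :: 'a \<Rightarrow> real)" "0 < e"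
        "{y. \<forall>f\<in>\<Psi>. \<bar>f y - f x\<bar> < e} \<subseteq> b"
      using Int.IH(2)[OF \<open>x \<in> b\<close>] by (elim exE conjE)
    have "{y. \<forall>f\<in>\<Phi> \<union> \<Psi>. \<bar>f y - f x\<bar> < min d e} \<subseteq> a \<inter> b"
      using \<Phi>(4) \<Psi>(4) by fastforce
    with \<Phi>(1-3) \<Psi>(1-3) show ?case
      by (intro exI[of _ "\<Phi> \<union> \<Psi>"] exI[of _ "min d e"]) (simp add: ball_Un)
  next
    case (UN K)
    then obtain k where k: "k \<in> K" "x \<in> k"
      by blast
    obtain \<Phi> e where "finite \<Phi>" "\<forall>f\<in>\<Phi>. bounded_linear (f :: 'a \<Rightarrow> real)" "0 < e"
        "{y. \<forall>f\<in>\<Phi>. \<bar>f y - f x\<bar> < e} \<subseteq> k"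
      using UN.IH[OF k] by (elim exE conjE)
    then show ?case
      using k(1) by (intro exI[of _ \<Phi>] exI[of _ e]) auto
  next
    case (Basis s)
    then obtain f :: "'a \<Rightarrow> real" and V where s: "s = f -` V" "bounded_linear f" "open V"
      by (elim CollectE exE conjE)
    have "f x \<in> V"
      using Basis(2) s(1) by simp
    then have "\<exists>e>0. \<forall>z. dist z (f x) < e \<longrightarrow> z \<in> V"
      using s(3) by (simp add: open_dist)
    then obtain e where "0 < e" "\<forall>z. dist z (f x) < e \<longrightarrow> z \<in> V"
      by (elim exE conjE)
    then show ?case
      using s(1,2) by (intro exI[of _ "{f}"] exI[of _ e]) (auto simp: dist_real_def)
  qed
qed

lemma openin_weak_imp_open:
  assumes "openin weak_topology U"
  shows "open U"
proof -
  have "generate_topology_on {f -` U | (f :: 'a \<Rightarrow> real) U. bounded_linear f \<and> open U} U"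
    using assms unfolding weak_topology_def openin_topology_generated_by_iff .
  then show ?thesis
  proof induction
    case (Basis s)
    then obtain f :: "'a \<Rightarrow> real" and V where "s = f -` V" "bounded_linear f" "open V"
      by blast
    then show ?case
      by (simp add: open_vimage linear_continuous_on)
  qed auto
qed

text \<open>Only small norm balls matter as norm neighbourhoods, and intersections with \<open>C\<close> make the
  subspace topologies disappear.\<close>

lemma points_of_continuity_iff:
  "x \<in> points_of_continuity C \<longleftrightarrow> x \<in> C \<and>
     (\<forall>e>0. \<exists>W. openin weak_topology W \<and> x \<in> W \<and> (\<forall>y\<in>W \<inter> C. dist y x < e))"
proof -
  have "topcontinuous_at (subtopology weak_topology C) (top_of_set C) (\<lambda>y. y) x \<longleftrightarrow>
     (\<forall>e>0. \<exists>W. openin weak_topology W \<and> x \<in> W \<and> (\<forall>y\<in>W \<inter> C. dist y x < e))"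
    (is "?L \<longleftrightarrow> ?R") if "x \<in> C"
  proof
    assume L: ?L
    show ?R
    proof (intro allI impI)
      fix e :: real assume "0 < e"
      have "openin (top_of_set C) (C \<inter> ball x e)"
        by (simp add: openin_open_Int)
      then obtain U where "openin (subtopology weak_topology C) U" "x \<in> U" "\<forall>y\<in>U. y \<in> C \<inter> ball x e"
        using L \<open>0 < e\<close> \<open>x \<in> C\<close> unfolding topcontinuous_at_def
        by (metis IntI centre_in_ball)
      then show "\<exists>W. openin weak_topology W \<and> x \<in> W \<and> (\<forall>y\<in>W \<inter> C. dist y x < e)"
        unfolding openin_subtopology by (metis IntE dist_commute mem_ball)
    qed
  next
    assume R: ?R
    have "\<exists>U. openin (subtopology weak_topology C) U \<and> x \<in> U \<and> (\<forall>y\<in>U. y \<in> V)"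
      if V: "openin (top_of_set C) V" "x \<in> V" for V
    proof -
      obtain e where "0 < e" "ball x e \<inter> C \<subseteq> V"
        using V openin_contains_ball[of C V] by blast
      moreover from this obtain W where "openin weak_topology W" "x \<in> W" "\<forall>y\<in>W \<inter> C. dist y x < e"
        using R by blast
      ultimately show ?thesis
        using \<open>x \<in> C\<close> unfolding openin_subtopology
        by (intro exI[of _ "W \<inter> C"]) (auto simp: dist_commute subset_iff)
    qed
    then show ?L
      using \<open>x \<in> C\<close> by (auto simp: topcontinuous_at_def)
  qed
  then show ?thesis
    unfolding points_of_continuity_def by blast
qed

lemma points_of_continuity_subset: "points_of_continuity C \<subseteq> C"
  by (auto simp: points_of_continuity_def)

text \<open>A weakly open set that meets \<open>C\<close> contains some \<open>d\<close> of the dense set and, being norm open, a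
  norm ball around \<open>d\<close>. Since \<open>d\<close> is a point of continuity, that ball contains the trace on \<open>C\<close> of a
  weakly open set, and countably many radii suffice.\<close>

lemma countable_pi_base_weak:
  assumes "countable D" and D: "D \<subseteq> points_of_continuity C"
    and dense: "\<And>U. openin weak_topology U \<Longrightarrow> U \<inter> C \<noteq> {} \<Longrightarrow> U \<inter> D \<noteq> {}"
  shows "\<exists>\<V>. countable \<V> \<and> pi_base (subtopology weak_topology C) \<V>"
proof -
  have "\<exists>W. openin weak_topology W \<and> d \<in> W \<and> (\<forall>y\<in>W \<inter> C. dist y d < inverse (real (Suc n)))"
    if "d \<in> D" for d n
    using D that unfolding points_of_continuity_iff subset_iff by simp
  then obtain W where W: "\<And>d n. d \<in> D \<Longrightarrow> openin weak_topology (W d n) \<and> d \<in> W d n \<and>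
      (\<forall>y\<in>W d n \<inter> C. dist y d < inverse (real (Suc n)))"
    by metis
  define \<V> where "\<V> = (\<lambda>(d, n). W d n \<inter> C) ` (D \<times> UNIV)"
  have "countable \<V>"
    unfolding \<V>_def using \<open>countable D\<close> by auto
  moreover have "pi_base (subtopology weak_topology C) \<V>"
    unfolding pi_base_def
  proof (intro conjI ballI allI impI)
    fix V assume "V \<in> \<V>"
    then obtain d n where d: "d \<in> D" "V = W d n \<inter> C"
      unfolding \<V>_def by auto
    then show "openin (subtopology weak_topology C) V"
      using W by (auto simp: openin_subtopology)
    have "d \<in> C"
      using D d(1) points_of_continuity_subset by blast
    then show "V \<noteq> {}"
      using d W by blast
  next
    fix U assume U: "openin (subtopology weak_topology C) U \<and> U \<noteq> {}"
    then obtain U' where U': "openin weak_topology U'" "U = U' \<inter> C"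
      unfolding openin_subtopology by blast
    then obtain d where d: "d \<in> D" "d \<in> U'"
      using dense U by blast
    obtain e where e: "0 < e" "ball d e \<subseteq> U'"
      using openin_weak_imp_open[OF U'(1)] d(2) open_contains_ball by blast
    then obtain n where n: "inverse (real (Suc n)) < e"
      using reals_Archimedean by blast
    have "W d n \<inter> C \<subseteq> U"
      using W[OF d(1), of n] e(2) n U'(2) by (force simp: dist_commute)
    then show "\<exists>V\<in>\<V>. V \<subseteq> U"
      using d(1) unfolding \<V>_def by force
  qed
  ultimately show ?thesis by blast
qed

text \<open>The values of finitely many functionals along a bounded sequence lie in a box, which is cut into
  finitely many cells of side \<open>e\<close>. By the pigeonhole principle some cell is hit twice beyond any
  given index.\<close>

lemma bounded_sequence_functionals_nearly_agree:
  fixes u :: "nat \<Rightarrow> 'a::real_normed_vector"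
  assumes "finite \<Phi>" and \<Phi>: "\<And>f. f \<in> \<Phi> \<Longrightarrow> bounded_linear (f :: 'a \<Rightarrow> real)"
    and u: "\<And>m. norm (u m) \<le> B" and "0 < e"
  obtains m n where "N < m" "m < n" "\<And>f. f \<in> \<Phi> \<Longrightarrow> \<bar>f (u m) - f (u n)\<bar> < e"
proof -
  \<comment> \<open>\<open>g m\<close> is the cell of \<open>u m\<close>.\<close>
  define g where "g m = (\<lambda>f\<in>\<Phi>. \<lfloor>f (u m) / e\<rfloor>)" for m
  have "\<exists>K. \<forall>m. \<bar>f (u m) / e\<bar> \<le> K" if f: "f \<in> \<Phi>" for f
  proof -
    obtain K where K: "\<And>x. norm (f x) \<le> norm x * K" "0 \<le> K"
      using bounded_linear.nonneg_bounded[OF \<Phi>[OF f]] by blast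
    have "\<bar>f (u m)\<bar> \<le> B * K" for m
      using K(1)[of "u m"] mult_right_mono[OF u[of m] K(2)] by simp
    then show ?thesis
      using \<open>0 < e\<close> by (intro exI[of _ "B * K / e"]) (simp add: divide_right_mono)
  qed
  then have "\<exists>K. \<forall>f\<in>\<Phi>. \<forall>m. \<bar>f (u m) / e\<bar> \<le> K f"
    by (intro bchoice) blast
  then obtain K where K: "\<And>f m. f \<in> \<Phi> \<Longrightarrow> \<bar>f (u m) / e\<bar> \<le> K f"
    by blast
  have "g m \<in> (\<Pi>\<^sub>E f\<in>\<Phi>. {\<lfloor>- K f\<rfloor>..\<lfloor>K f\<rfloor>})" for m
  proof -
    have "- K f \<le> f (u m) / e" "f (u m) / e \<le> K f" if "f \<in> \<Phi>" for f
      using K[OF that, of m] by linarith+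
    then show ?thesis
      unfolding g_def by (auto intro!: floor_mono)
  qed
  then have "g ` {N<..} \<subseteq> (\<Pi>\<^sub>E f\<in>\<Phi>. {\<lfloor>- K f\<rfloor>..\<lfloor>K f\<rfloor>})"
    by blast
  then have "finite (g ` {N<..})"
    by (rule finite_subset) (simp add: finite_PiE \<open>finite \<Phi>\<close>)
  then have "\<not> inj_on g {N<..}"
    using finite_imageD infinite_Ioi by blast
  then obtain i j where ij: "N < i" "N < j" "g i = g j" "i \<noteq> j"
    unfolding inj_on_def by auto
  then obtain m n where mn: "N < m" "m < n" "g m = g n"
    using that[of i j] that[of j i] by (cases "i < j") auto
  have "\<bar>f (u m) - f (u n)\<bar> < e" if "f \<in> \<Phi>" for f
  proof -
    have "\<lfloor>f (u m) / e\<rfloor> = \<lfloor>f (u n) / e\<rfloor>"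
      using fun_cong[OF mn(3), of f] that by (simp add: g_def)
    then have "\<bar>f (u m) / e - f (u n) / e\<bar> < 1"
      by linarith
    then show ?thesis
      using \<open>0 < e\<close> by (simp add: abs_less_iff field_simps)
  qed
  then show thesis
    by (rule that[OF mn(1,2)])
qed

section \<open>Sums along finite branches\<close>

definition path_sum :: "(node \<Rightarrow> real) \<Rightarrow> node \<Rightarrow> real" where
  "path_sum f s = (\<Sum>k\<le>length s. \<bar>f (take k s)\<bar>)"

lemma inj_on_take: "inj_on (\<lambda>k. take k s) {..length s}"
  by (rule inj_onI) (metis atMost_iff length_take min.absorb2)

lemma path_sum_eq: "path_sum f s = (\<Sum>t | prefix t s. \<bar>f t\<bar>)"
proof -
  have "{t. prefix t s} = (\<lambda>k. take k s) ` {..length s}"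
    by (auto simp: image_iff take_is_prefix prefix_length_le)
      (metis append_eq_conv_conj atMost_iff prefix_def prefix_length_le)
  then show ?thesis
    by (simp add: path_sum_def sum.reindex[OF inj_on_take])
qed

lemma finite_prefixes: "finite {t. prefix t s}"
  by (rule finite_subset[of _ "set (prefixes s)"]) auto

lemma prefixes_chain: "{t. prefix t s} \<in> tree_chains"
  unfolding tree_chains_def chain_def using prefix_same_cases by auto

lemma path_sum_le_norm: "path_sum (tree_coord x) s \<le> norm x"
  unfolding path_sum_eq norm_tree_space
  by (rule sum_le_tree_norm[OF tree_coord_bounded prefixes_chain finite_prefixes])

text \<open>The longest element of a finite chain extends all others; padding it makes the path as long as
  desired.\<close>

lemma finite_chain_subset_prefixes:
  assumes "F \<in> tree_chains" "finite F"
  obtains s where "n \<le> length s" "F \<subseteq> {t. prefix t s}"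
proof -
  have "finite (length ` F)" "length ` F \<noteq> {}"
    using assms by (auto simp: tree_chains_def)
  then have "Max (length ` F) \<in> length ` F"
    by (rule Max_in)
  then obtain m where m: "m \<in> F" "length m = Max (length ` F)"
    by auto
  have "prefix t m" if "t \<in> F" for t
  proof -
    have "prefix t m \<or> prefix m t"
      using assms(1) that m(1) by (auto simp: tree_chains_def chain_def)
    moreover have "length t \<le> length m"
      using m(2) assms(2) that by simp
    ultimately show ?thesis
      by (metis prefix_length_prefix prefix_order.refl)
  qed
  then have "F \<subseteq> {t. prefix t (m @ replicate n False)}"
    by (auto intro: prefix_order.trans)
  then show thesis
    by (intro that[of "m @ replicate n False"]) auto
qed

text \<open>The norm is determined by paths, and short paths can be ignored because a path sum only grows
  when the path is prolonged.\<close>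

lemma norm_le_path_sum:
  assumes "\<And>s. n \<le> length s \<Longrightarrow> path_sum (tree_coord x) s \<le> M"
  shows "norm x \<le> M"
  unfolding norm_tree_space
proof (rule tree_norm_bound(2))
  fix F assume F: "F \<in> tree_chains" "finite F"
  then obtain s where s: "n \<le> length s" "F \<subseteq> {t. prefix t s}"
    by (rule finite_chain_subset_prefixes)
  have "(\<Sum>t\<in>F. \<bar>tree_coord x t\<bar>) \<le> path_sum (tree_coord x) s"
    unfolding path_sum_eq by (rule sum_mono2[OF finite_prefixes s(2)]) auto
  also have "\<dots> \<le> M"
    by (rule assms) (rule s(1))
  finally show "(\<Sum>t\<in>F. \<bar>tree_coord x t\<bar>) \<le> M" .
qed

lemma path_sum_split:
  assumes "n \<le> length s"
  shows "path_sum f s = path_sum f (take n s) + (\<Sum>k\<in>{n<..length s}. \<bar>f (take k s)\<bar>)"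
proof -
  have "{..length s} = {..n} \<union> {n<..length s}"
    using assms by auto
  moreover have "{..n} \<inter> {n<..length s} = {}" by auto
  ultimately have "path_sum f s = (\<Sum>k\<le>n. \<bar>f (take k s)\<bar>) + (\<Sum>k\<in>{n<..length s}. \<bar>f (take k s)\<bar>)"
    unfolding path_sum_def by (simp add: sum.union_disjoint)
  moreover have "path_sum f (take n s) = (\<Sum>k\<le>n. \<bar>f (take k s)\<bar>)"
    unfolding path_sum_def using assms by (intro sum.cong) (auto simp: min_def)
  ultimately show ?thesis by simp
qed

section \<open>Saturated points are points of continuity\<close>

definition saturated :: "tree_space \<Rightarrow> bool" where
  "saturated y \<longleftrightarrow> norm y \<le> 1 \<and> (\<exists>n. \<forall>s. length s = n \<longrightarrow> path_sum (tree_coord y) s = 1)"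

lemma bounded_linear_tree_coord: "bounded_linear (\<lambda>x. tree_coord x t)"
  by (rule bounded_linear_intro[where K = 1]) (simp_all add: abs_tree_coord_le_norm)

lemma finite_nodes_upto: "finite {t :: node. length t \<le> n}"
  using finite_lists_length_le[of "UNIV :: bool set" n] by simp

text \<open>If \<open>u\<close> has spent nearly all of its norm on the path up to level \<open>n\<close>, little is left beyond it.
  This is used with \<open>d = 0\<close> for a saturated point and with small \<open>d\<close> for the points near it.\<close>

lemma tail_le_of_path_sum_ge:
  assumes "norm u \<le> 1" "length s \<ge> n" "1 - d \<le> path_sum (tree_coord u) (take n s)"
  shows "(\<Sum>k\<in>{n<..length s}. \<bar>tree_coord u (take k s)\<bar>) \<le> d"
  using path_sum_le_norm[of u s] path_sum_split[OF assms(2), of "tree_coord u"] assms(1,3) by linarith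

text \<open>The difference \<open>u - y\<close> is small up to level \<open>n\<close> because finitely many coordinates are close, and
  small below it because both \<open>u\<close> and \<open>y\<close> have small tails there.\<close>

lemma saturated_point_of_continuity:
  assumes "saturated y"
  shows "y \<in> points_of_continuity (cball 0 1)"
  unfolding points_of_continuity_iff
proof (intro conjI allI impI)
  show "y \<in> cball 0 1"
    using assms by (simp add: saturated_def)
  fix e :: real assume "0 < e"
  obtain n where n: "\<And>s. length s = n \<Longrightarrow> path_sum (tree_coord y) s = 1" and y: "norm y \<le> 1"
    using assms by (auto simp: saturated_def)
  \<comment> \<open>A path up to level \<open>n\<close> has \<open>n + 1\<close> nodes, so coordinates within \<open>d\<close> change its sum by at most
    \<open>e / 4\<close>.\<close>
  define d where "d = e / (4 * (real n + 1))"
  have d: "0 < d" "(real n + 1) * d = e / 4"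
    using \<open>0 < e\<close> by (auto simp: d_def field_simps)
  define W where "W = (\<Inter>t\<in>{t. length t \<le> n}. (\<lambda>x. tree_coord x t) -` ball (tree_coord y t) d)"
  have "openin weak_topology W"
    unfolding W_def
  proof (intro openin_Inter)
    show "finite ((\<lambda>t. (\<lambda>x. tree_coord x t) -` ball (tree_coord y t) d) ` {t. length t \<le> n})"
      using finite_nodes_upto by simp
    have "[] \<in> {t :: node. length t \<le> n}"
      by simp
    then show "(\<lambda>t. (\<lambda>x. tree_coord x t) -` ball (tree_coord y t) d) ` {t. length t \<le> n} \<noteq> {}"
      by blast
  qed (auto intro: openin_weak_functional bounded_linear_tree_coord)
  moreover have "y \<in> W"
    using d by (simp add: W_def)
  moreover have "\<forall>u\<in>W \<inter> cball 0 1. dist u y < e"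
  proof
    fix u assume u: "u \<in> W \<inter> cball 0 1"
    then have u1: "norm u \<le> 1"
      by simp
    have uW: "\<bar>tree_coord u t - tree_coord y t\<bar> < d" if "length t \<le> n" for t
      using u that by (auto simp: W_def dist_real_def abs_minus_commute)
    have "path_sum (tree_coord (u - y)) s \<le> e / 2" if s: "n \<le> length s" for s
    proof -
      have "\<bar>tree_coord (u - y) (take k s)\<bar> \<le> d" if "k \<le> n" for k
        using uW[of "take k s"] that s by simp
      then have "(\<Sum>k\<le>n. \<bar>tree_coord (u - y) (take k s)\<bar>) \<le> (real n + 1) * d"
        using sum_bounded_above[of "{..n}" "\<lambda>k. \<bar>tree_coord (u - y) (take k s)\<bar>" d]
        by (simp add: add.commute)
      then have head: "path_sum (tree_coord (u - y)) (take n s) \<le> e / 4"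
        using s d(2) by (simp add: path_sum_def min_def)
      have "path_sum (tree_coord y) (take n s) \<le>
          path_sum (tree_coord u) (take n s) + path_sum (tree_coord (u - y)) (take n s)"
        unfolding path_sum_def sum.distrib[symmetric] by (intro sum_mono) simp
      then have "1 - e / 4 \<le> path_sum (tree_coord u) (take n s)"
        using head n[of "take n s"] s by simp
      then have tail_u: "(\<Sum>k\<in>{n<..length s}. \<bar>tree_coord u (take k s)\<bar>) \<le> e / 4"
        using tail_le_of_path_sum_ge[OF u1 s] by blast
      have tail_y: "(\<Sum>k\<in>{n<..length s}. \<bar>tree_coord y (take k s)\<bar>) \<le> 0"
        using tail_le_of_path_sum_ge[OF y s] n[of "take n s"] s by simp
      have "(\<Sum>k\<in>{n<..length s}. \<bar>tree_coord (u - y) (take k s)\<bar>) \<le>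
          (\<Sum>k\<in>{n<..length s}. \<bar>tree_coord u (take k s)\<bar>) +
          (\<Sum>k\<in>{n<..length s}. \<bar>tree_coord y (take k s)\<bar>)"
        unfolding sum.distrib[symmetric] by (intro sum_mono) simp
      then show ?thesis
        using path_sum_split[OF s, of "tree_coord (u - y)"] head tail_u tail_y by linarith
    qed
    then have "norm (u - y) \<le> e / 2"
      by (rule norm_le_path_sum)
    then show "dist u y < e"
      using \<open>0 < e\<close> by (simp add: dist_norm)
  qed
  ultimately show "\<exists>W. openin weak_topology W \<and> y \<in> W \<and> (\<forall>u\<in>W \<inter> cball 0 1. dist u y < e)"
    by (intro exI[of _ W] conjI)
qed

section \<open>A countable weakly dense set of saturated points\<close>

definition rational_vectors :: "tree_space set" where
  "rational_vectors = {x. tree_coord x \<in> finitely_supported \<and> (\<forall>t. tree_coord x t \<in> \<rat>)}"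

lemma countable_rational_vectors: "countable rational_vectors"
proof -
  \<comment> \<open>A vector is determined by the graph of its restriction to its support.\<close>
  define g where "g x = {(t, tree_coord x t) | t. tree_coord x t \<noteq> 0}" for x
  have "x = y" if "g x = g y" for x y
  proof (rule tree_space_eqI)
    fix t
    have *: "(t, c) \<in> g x \<longleftrightarrow> (t, c) \<in> g y" for c
      using that by simp
    show "tree_coord x t = tree_coord y t"
      using *[of "tree_coord x t"] *[of "tree_coord y t"] by (auto simp: g_def)
  qed
  then have inj: "inj_on g rational_vectors"
    by (auto intro: inj_onI)
  have "g ` rational_vectors \<subseteq> {A. A \<subseteq> UNIV \<times> \<rat> \<and> finite A}"
    by (auto simp: g_def rational_vectors_def finitely_supported_def)
  moreover have "countable {A. A \<subseteq> (UNIV :: node set) \<times> (\<rat> :: real set) \<and> finite A}"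
    using countable_Collect_finite_subset[of "(UNIV :: node set) \<times> (\<rat> :: real set)"]
    by (simp add: countable_rat conj_commute)
  ultimately have "countable (g ` rational_vectors)"
    by (rule countable_subset)
  then show ?thesis
    using inj by (rule countable_image_inj_on)
qed

lemma closure_rational_vectors: "closure rational_vectors = UNIV"
proof -
  have "x \<in> closure rational_vectors" if x: "tree_coord x \<in> finitely_supported" for x
    unfolding closure_approachable
  proof (intro allI impI)
    fix e :: real assume "0 < e"
    define S where "S = {t. tree_coord x t \<noteq> 0}"
    have "finite S"
      using x by (simp add: S_def finitely_supported_def)
    define d where "d = e / (2 * (real (card S) + 1))"
    have "0 < d" "real (card S) * d < e"
      using \<open>0 < e\<close> by (auto simp: d_def field_simps add_nonneg_pos)
    have "\<exists>q\<in>\<rat>. \<bar>c - q\<bar> < d" for c :: real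
      using Rats_dense_in_real[of "c - d" c] \<open>0 < d\<close> by force
    then have "\<exists>q. \<forall>c :: real. q c \<in> \<rat> \<and> \<bar>c - q c\<bar> < d"
      by (intro choice) blast
    then obtain q where q: "\<And>c :: real. q c \<in> \<rat>" "\<And>c. \<bar>c - q c\<bar> < d"
      by blast
    define f where "f t = (if t \<in> S then q (tree_coord x t) else 0)" for t
    have f: "f \<in> finitely_supported"
      unfolding finitely_supported_def using \<open>finite S\<close> by (auto simp: f_def)
    then obtain y where y: "tree_coord y = f"
      using ex_tree_coord by blast
    have "norm (y - x) \<le> real (card S) * d"
      unfolding norm_tree_space
    proof (rule tree_norm_bound(2))
      fix F :: "node set" assume "finite F"
      have "(\<Sum>t\<in>F. \<bar>tree_coord (y - x) t\<bar>) = (\<Sum>t\<in>F \<inter> S. \<bar>tree_coord (y - x) t\<bar>)"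
        using \<open>finite F\<close> by (intro sum.mono_neutral_right) (auto simp: y f_def S_def)
      also have "\<dots> \<le> (\<Sum>t\<in>S. \<bar>tree_coord (y - x) t\<bar>)"
        using \<open>finite S\<close> by (intro sum_mono2) auto
      also have "\<dots> \<le> real (card S) * d"
        using q(2) by (intro sum_bounded_above) (auto simp: y f_def abs_minus_commute less_imp_le)
      finally show "(\<Sum>t\<in>F. \<bar>tree_coord (y - x) t\<bar>) \<le> real (card S) * d" .
    qed
    then have "dist y x < e"
      using \<open>real (card S) * d < e\<close> by (simp add: dist_norm)
    moreover have "y \<in> rational_vectors"
      using f q(1) by (simp add: rational_vectors_def y f_def)
    ultimately show "\<exists>y\<in>rational_vectors. dist y x < e" by blast
  qed
  then have "closure {x. tree_coord x \<in> finitely_supported} \<subseteq> closure rational_vectors"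
    by (intro closure_minimal) auto
  then show ?thesis
    using closure_finitely_supported by auto
qed

text \<open>The closed ball is the closure of the open ball, so an open set that meets it also meets the open
  ball, in an open set; there density applies without leaving the ball.\<close>

lemma rational_vector_in_open:
  assumes "open U" "U \<inter> cball 0 1 \<noteq> {}"
  obtains x where "x \<in> rational_vectors" "x \<in> U" "norm x \<le> 1"
proof -
  have "U \<inter> closure (ball 0 1) \<noteq> {}"
    using assms(2) by simp
  then have "U \<inter> ball 0 1 \<noteq> {}"
    using open_Int_closure_eq_empty[OF \<open>open U\<close>, of "ball 0 1"] by simp
  then have "(U \<inter> ball 0 1) \<inter> closure rational_vectors \<noteq> {}"
    by (simp add: closure_rational_vectors)
  then have "(U \<inter> ball 0 1) \<inter> rational_vectors \<noteq> {}"
    using open_Int_closure_eq_empty[of "U \<inter> ball 0 1" rational_vectors] \<open>open U\<close> by (simp add: open_Int)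
  then obtain x where "x \<in> rational_vectors" "x \<in> U" "norm x < 1"
    by auto
  then show thesis
    by (intro that) auto
qed

lemma Rats_sum: "(\<And>i. i \<in> A \<Longrightarrow> f i \<in> \<rat>) \<Longrightarrow> sum f A \<in> \<rat>"
  by (induction A rule: infinite_finite_induct) auto

text \<open>The vector \<open>u m\<close> places at each node of level \<open>m > N\<close> what \<open>x\<close> leaves unspent on the path to that
  node. Adding half of it at level \<open>m\<close> and half, with the opposite sign, at level \<open>n\<close> saturates \<open>x\<close>, while a functional
  that hardly distinguishes \<open>u m\<close> from \<open>u n\<close> hardly sees the change.\<close>

lemma saturation:
  assumes x: "x \<in> rational_vectors" "norm x \<le> 1"
  obtains u :: "nat \<Rightarrow> tree_space" and N :: nat where "\<And>m. norm (u m) \<le> 1"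
    "\<And>m n. N < m \<Longrightarrow> m < n \<Longrightarrow> x + (1/2) *\<^sub>R (u m - u n) \<in> {y \<in> rational_vectors. saturated y}"
proof -
  define S where "S = {t. tree_coord x t \<noteq> 0}"
  have "finite S"
    using x by (simp add: S_def rational_vectors_def finitely_supported_def)
  then obtain N where N: "\<And>t. t \<in> S \<Longrightarrow> length t \<le> N"
    by (metis finite_imageI finite_nat_set_iff_bounded_le imageI)
  define r where "r t = 1 - path_sum (tree_coord x) t" for t
  have r: "0 \<le> r t" "r t \<le> 1" for t
    using path_sum_le_norm[of x t] x by (auto simp: r_def path_sum_def sum_nonneg)
  have rat: "r t \<in> \<rat>" for t
    using x by (simp add: r_def path_sum_def Rats_sum rational_vectors_def)
  define g where "g m s = (if length s = m then r (take N s) else 0)" for m s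
  have gfs: "g m \<in> finitely_supported" for m
    unfolding finitely_supported_def g_def
    by (auto intro: finite_subset[OF _ finite_nodes_upto[of m]])
  have "\<exists>u. \<forall>m. tree_coord (u m) = g m"
    by (intro choice allI ex_tree_coord gfs)
  then obtain u where u: "\<And>m. tree_coord (u m) = g m"
    by blast
  have "norm (u m) \<le> 1" for m
  proof (rule norm_le_path_sum[of 0])
    fix s :: node
    have "path_sum (g m) s = (\<Sum>k\<in>{..length s} \<inter> {m}. r (take N (take k s)))"
      unfolding path_sum_def using r
      by (intro sum.mono_neutral_cong_right) (auto simp: g_def min_def)
    also have "\<dots> \<le> 1"
      using r by (cases "m \<le> length s") auto
    finally show "path_sum (tree_coord (u m)) s \<le> 1"
      by (simp add: u)
  qed
  moreover have "x + (1/2) *\<^sub>R (u m - u n) \<in> {y \<in> rational_vectors. saturated y}"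
    if mn: "N < m" "m < n" for m n
  proof -
    define y where "y = x + (1/2) *\<^sub>R (u m - u n)"
    have cy: "tree_coord y t = tree_coord x t + (g m t - g n t) / 2" for t
      by (simp add: y_def u)
    have "{t. tree_coord y t \<noteq> 0} \<subseteq> S \<union> {t. g m t \<noteq> 0} \<union> {t. g n t \<noteq> 0}"
      by (auto simp: cy S_def)
    then have "finite {t. tree_coord y t \<noteq> 0}"
      by (rule finite_subset) (use \<open>finite S\<close> gfs in \<open>simp add: finitely_supported_def\<close>)
    moreover have "g k t \<in> \<rat>" for k t
      using rat by (simp add: g_def)
    ultimately have "y \<in> rational_vectors"
      using x by (simp add: rational_vectors_def finitely_supported_def cy)
    moreover have total: "path_sum (tree_coord y) s = 1" if s: "n \<le> length s" for s
    proof -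
      have y0: "tree_coord y (take k s) = tree_coord x (take k s)" if "k \<le> N" for k
        using that mn s by (simp add: cy g_def)
      have "path_sum (tree_coord y) (take N s) = path_sum (tree_coord x) (take N s)"
        unfolding path_sum_def using y0 mn s by (intro sum.cong) (auto simp: min_def)
      then have head: "path_sum (tree_coord y) (take N s) = 1 - r (take N s)"
        by (simp add: r_def)
      have x0: "tree_coord x (take k s) = 0" if "N < k" "k \<le> length s" for k
        using N[of "take k s"] that by (auto simp: S_def)
      \<comment> \<open>Beyond level \<open>N\<close> the path meets the support of \<open>y\<close> in the levels \<open>m\<close> and \<open>n\<close> at most.\<close>
      have "(\<Sum>k\<in>{N<..length s}. \<bar>tree_coord y (take k s)\<bar>) = (\<Sum>k\<in>{m, n}. r (take N s) / 2)"
        using mn s r x0 x0[of "length s"] by (intro sum.mono_neutral_cong_right) (auto simp: cy g_def min_def)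
      also have "\<dots> = r (take N s)"
        using mn by simp
      finally show ?thesis
        using path_sum_split[of N s "tree_coord y"] head mn s by simp
    qed
    moreover have "norm y \<le> 1"
      using norm_le_path_sum[of n y 1] total by simp
    ultimately show ?thesis
      unfolding saturated_def y_def[symmetric] by (auto intro!: exI[of _ n])
  qed
  ultimately show thesis
    by (rule that)
qed

lemma rational_saturated_weakly_dense:
  assumes U: "openin weak_topology U" "U \<inter> cball 0 1 \<noteq> {}"
  shows "U \<inter> {y \<in> rational_vectors. saturated y} \<noteq> {}"
proof -
  obtain x where x: "x \<in> rational_vectors" "x \<in> U" "norm x \<le> 1"
    by (rule rational_vector_in_open[OF openin_weak_imp_open[OF U(1)] U(2)])
  obtain \<Phi> e where \<Phi>: "finite \<Phi>" "\<forall>f\<in>\<Phi>. bounded_linear (f :: tree_space \<Rightarrow> real)" "0 < e"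
    "{y. \<forall>f\<in>\<Phi>. \<bar>f y - f x\<bar> < e} \<subseteq> U"
    using weak_neighbourhood_functionals[OF U(1) x(2)] by (elim exE conjE)
  obtain u :: "nat \<Rightarrow> tree_space" and N :: nat where u: "\<And>m. norm (u m) \<le> 1"
    "\<And>m n. N < m \<Longrightarrow> m < n \<Longrightarrow> x + (1/2) *\<^sub>R (u m - u n) \<in> {y \<in> rational_vectors. saturated y}"
    by (rule saturation[OF x(1,3)]) (rule that)
  obtain m n where mn: "N < m" "m < n" "\<And>f. f \<in> \<Phi> \<Longrightarrow> \<bar>f (u m) - f (u n)\<bar> < e"
    by (rule bounded_sequence_functionals_nearly_agree[where u = u and N = N,
          OF \<Phi>(1) bspec[OF \<Phi>(2)] u(1) \<Phi>(3)]) (assumption, rule that)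
  define y where "y = x + (1/2) *\<^sub>R (u m - u n)"
  have "\<bar>f y - f x\<bar> < e" if "f \<in> \<Phi>" for f
  proof -
    interpret bounded_linear f
      using \<Phi>(2) that by (rule bspec)
    show ?thesis
      using mn(3)[OF that] by (simp add: y_def add diff scaleR)
  qed
  then have "y \<in> U"
    using \<Phi>(4) by blast
  moreover have "y \<in> {y \<in> rational_vectors. saturated y}"
    unfolding y_def by (rule u(2)[OF mn(1,2)])
  ultimately show ?thesis
    by blast
qed

theorem theorem3p17:
  shows "subtopology weak_topology (cball (0::tree_space) 1)
           closure_of points_of_continuity (cball (0::tree_space) 1) = cball (0::tree_space) 1
       \<and> (\<exists>\<V>. countable \<V> \<and> pi_base (subtopology weak_topology (cball (0::tree_space) 1)) \<V>)"
proof
  let ?C = "cball (0::tree_space) 1" and ?D = "{y \<in> rational_vectors. saturated y}"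
  have D: "?D \<subseteq> points_of_continuity ?C"
    using saturated_point_of_continuity by blast
  show "subtopology weak_topology ?C closure_of points_of_continuity ?C = ?C"
  proof (rule antisym)
    show "subtopology weak_topology ?C closure_of points_of_continuity ?C \<subseteq> ?C"
      using closure_of_subset_topspace[of "subtopology weak_topology ?C"] by simp
    show "?C \<subseteq> subtopology weak_topology ?C closure_of points_of_continuity ?C"
    proof
      fix x assume x: "x \<in> ?C"
      have "\<exists>y. y \<in> points_of_continuity ?C \<and> y \<in> T"
        if T: "x \<in> T" "openin (subtopology weak_topology ?C) T" for T
      proof -
        obtain U where U: "openin weak_topology U" "T = U \<inter> ?C"
          using T(2) unfolding openin_subtopology by (elim exE conjE)
        have "U \<inter> ?C \<noteq> {}"
          using T(1) U(2) by (metis empty_iff)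
        then obtain y where y: "y \<in> U" "y \<in> ?D"
          using rational_saturated_weakly_dense[OF U(1)] by (metis disjoint_iff)
        have "y \<in> points_of_continuity ?C"
          using D y(2) by (rule subsetD)
        then show ?thesis
          using U(2) y(1) points_of_continuity_subset[of ?C] by (intro exI[of _ y]) auto
      qed
      then show "x \<in> subtopology weak_topology ?C closure_of points_of_continuity ?C"
        using x by (simp add: in_closure_of)
    qed
  qed
  show "\<exists>\<V>. countable \<V> \<and> pi_base (subtopology weak_topology ?C) \<V>"
  proof (rule countable_pi_base_weak)
    show "countable ?D"
      by (rule countable_subset[OF _ countable_rational_vectors]) blast
    show "?D \<subseteq> points_of_continuity ?C"
      by (rule D)
  qed (rule rational_saturated_weakly_dense)
qed

end
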